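(* Let $n\ge 1$ and $A,T\in M_n(\mathbb{C})$. Let $m\ge 1$ and let $c_0,\dots,c_m\in\mathbb{C}$ with $c_m\neq 0$. Suppose that $$\sum_{k=0}^{m}c_k\,\Delta_A^k(T)=0$$ and that there exists $\theta\in\mathbb{R}$ such that $$\operatorname{Re}\bigl(e^{-i\theta}z\bigr)>0\qquad\text{for every root } z\in\mathbb{C} \text{ of } P(z)=\sum_{k=0}^{m}c_kz^k.$$ Then $\Delta_A^j(T)$ is nilpotent for every integer $j\ge 0$. In particular, both $T$ and $\Delta_A(T)$ are nilpotent.
   Context: $M_n(\mathbb{C})$ is the algebra of $n\times n$ complex matrices. For $A\in M_n(\mathbb{C})$ the inner derivation induced by $A$ is $\Delta_A(T)=AT-TA$ for $T\in M_n(\mathbb{C})$, with iterates $\Delta_A^0(T)=T$ and $\Delta_A^k(T)=\Delta_A(\Delta_A^{k-1}(T))$ for $k\ge1$. A matrix $M$ is nilpotent if $M^k=0$ for some $k\ge 1$. *)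

theory Defs
  imports "HOL-Analysis.Analysis"
begin

(* Pitfall: on complex^'n^'n the class operations * and ^ act entrywise, and *s scales only vectors
   over the entry type.  The matrix product is **; scaling and powers are introduced here. *)

definition mat_scale :: "complex \<Rightarrow> complex^'n^'m \<Rightarrow> complex^'n^'m" where
  "mat_scale c M = (\<chi> i j. c * M $ i $ j)"

primrec mat_power :: "complex^'n^'n \<Rightarrow> nat \<Rightarrow> complex^'n^'n" where
  "mat_power M 0 = mat 1"
| "mat_power M (Suc k) = M ** mat_power M k"

definition nilpotent_mat :: "complex^'n^'n \<Rightarrow> bool" where
  "nilpotent_mat M \<longleftrightarrow> (\<exists>k\<ge>1. mat_power M k = 0)"

definition inner_derivation :: "complex^'n^'n \<Rightarrow> complex^'n^'n \<Rightarrow> complex^'n^'n" where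
  "inner_derivation A T = A ** T - T ** A"

end

theory Submission
  imports Defs "HOL-Computational_Algebra.Fundamental_Theorem_Algebra"
begin

text \<open>
  Write \<open>\<Delta>\<close> for the inner derivation induced by \<open>A\<close>. By the fundamental theorem of algebra, the
  equation \<open>P(\<Delta>) T = 0\<close> says that \<open>T\<close> is annihilated by a product of operators \<open>\<Delta> - z\<close> with \<open>z\<close>
  running through the roots of \<open>P\<close>; that is, \<open>T\<close> is a sum of generalized eigenvectors of \<open>\<Delta>\<close>. Call \<open>X\<close>
  of weight at least \<open>r\<close> if it is annihilated by a product of operators \<open>\<Delta> - z\<close> with
  \<open>Re (u z) \<ge> r\<close>, where \<open>u = e\<^sup>-\<^sup>i\<^sup>\<theta>\<close> (\<open>weight_ge\<close>). As there are finitely many roots, \<open>T\<close> has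
  weight at least \<open>\<delta>\<close> for some \<open>\<delta> > 0\<close>.

  Since \<open>\<Delta>\<close> is a derivation,
  \<open>(\<Delta> - (z + w)) (X Y) = ((\<Delta> - z) X) Y + X ((\<Delta> - w) Y)\<close>,
  and therefore weights add under multiplication (\<open>weight_ge_mult\<close>): the power \<open>T\<^sup>k\<close> has weight at
  least \<open>k \<delta>\<close>. The eigenvalues of \<open>\<Delta>\<close> are bounded, because \<open>\<Delta>\<close> is a linear map on a
  finite-dimensional space, so only \<open>0\<close> has a very large weight (\<open>weight_ge_large_imp_zero\<close>). Hence
  \<open>T\<^sup>k = 0\<close> for large \<open>k\<close>. The matrices of weight at least \<open>\<delta>\<close> are stable under \<open>\<Delta>\<close>, so the same
  argument applies to every iterate \<open>\<Delta>\<^sup>j T\<close>.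
\<close>

section \<open>Scaling of matrices and linearity of the derivation\<close>

lemma mat_scale_add_right: "mat_scale a (X + Y) = mat_scale a X + mat_scale a Y"
  by (simp add: mat_scale_def vec_eq_iff algebra_simps)

lemma mat_scale_diff_right: "mat_scale a (X - Y) = mat_scale a X - mat_scale a Y"
  by (simp add: mat_scale_def vec_eq_iff algebra_simps)

lemma mat_scale_add_left: "mat_scale (a + b) X = mat_scale a X + mat_scale b X"
  by (simp add: mat_scale_def vec_eq_iff algebra_simps)

lemma mat_scale_diff_left: "mat_scale (a - b) X = mat_scale a X - mat_scale b X"
  by (simp add: mat_scale_def vec_eq_iff algebra_simps)

lemma mat_scale_mat_scale: "mat_scale a (mat_scale b X) = mat_scale (a * b) X"
  by (simp add: mat_scale_def vec_eq_iff algebra_simps)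

lemma mat_scale_zero_left [simp]: "mat_scale 0 X = 0"
  by (simp add: mat_scale_def vec_eq_iff)

lemma mat_scale_zero_right [simp]: "mat_scale a 0 = 0"
  by (simp add: mat_scale_def vec_eq_iff)

lemma mat_scale_one [simp]: "mat_scale 1 X = X"
  by (simp add: mat_scale_def vec_eq_iff)

lemma mat_scale_eq_0_iff: "mat_scale a X = 0 \<longleftrightarrow> a = 0 \<or> X = 0"
  by (auto simp: mat_scale_def vec_eq_iff)

lemma mat_scale_sum: "mat_scale a (\<Sum>k\<in>S. f k) = (\<Sum>k\<in>S. mat_scale a (f k))"
  by (induction S rule: infinite_finite_induct) (auto simp: mat_scale_add_right)

lemma mat_scale_mult_left: "mat_scale a X ** Y = mat_scale a (X ** Y)"
  by (simp add: mat_scale_def matrix_matrix_mult_def vec_eq_iff sum_distrib_left mult.assoc)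

lemma mat_scale_mult_right: "X ** mat_scale a Y = mat_scale a (X ** Y)"
  by (simp add: mat_scale_def matrix_matrix_mult_def vec_eq_iff sum_distrib_left algebra_simps)

lemma norm_mat_scale: "norm (mat_scale a X) = cmod a * norm X"
  by (simp add: mat_scale_def norm_vec_def norm_mult L2_set_right_distrib)

lemma matrix_diff_distrib_left: "X ** (Y - Z) = X ** Y - X ** (Z :: 'a :: ring_1^'n^'m)"
  by (simp add: matrix_matrix_mult_def vec_eq_iff sum_subtractf algebra_simps)

lemma matrix_diff_distrib_right: "(Y - Z) ** X = Y ** X - (Z :: 'a :: ring_1^'n^'m) ** X"
  by (simp add: matrix_matrix_mult_def vec_eq_iff sum_subtractf algebra_simps)

lemma matrix_add_distrib_right: "(Y + Z) ** X = Y ** X + (Z :: 'a :: semiring_1^'n^'m) ** X"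
  by (simp add: matrix_matrix_mult_def vec_eq_iff sum.distrib algebra_simps)

lemma inner_derivation_add:
  "inner_derivation A (X + Y) = inner_derivation A X + inner_derivation A Y"
  by (simp add: inner_derivation_def matrix_add_ldistrib matrix_add_distrib_right)

lemma inner_derivation_diff:
  "inner_derivation A (X - Y) = inner_derivation A X - inner_derivation A Y"
  by (simp add: inner_derivation_def matrix_diff_distrib_left matrix_diff_distrib_right)

lemma inner_derivation_mat_scale:
  "inner_derivation A (mat_scale a X) = mat_scale a (inner_derivation A X)"
  by (simp add: inner_derivation_def mat_scale_mult_left mat_scale_mult_right mat_scale_diff_right)

lemma inner_derivation_zero [simp]: "inner_derivation A 0 = 0"
  by (simp add: inner_derivation_def)

lemma inner_derivation_mat_1 [simp]: "inner_derivation A (mat 1) = 0"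
  by (simp add: inner_derivation_def)

lemma inner_derivation_mult:
  "inner_derivation A (X ** Y) = inner_derivation A X ** Y + X ** inner_derivation A Y"
  by (simp add: inner_derivation_def matrix_diff_distrib_left matrix_diff_distrib_right
      matrix_mul_assoc)

lemma linear_inner_derivation: "linear (inner_derivation A)"
proof
  fix r :: real and X
  have "r *\<^sub>R Y = mat_scale (complex_of_real r) Y" for Y :: "complex^'a^'a"
    by (simp add: mat_scale_def vec_eq_iff scaleR_conv_of_real[where 'a = complex])
  then show "inner_derivation A (r *\<^sub>R X) = r *\<^sub>R inner_derivation A X"
    by (simp add: inner_derivation_mat_scale)
qed (rule inner_derivation_add)

section \<open>Weights with respect to the derivation\<close>

definition shifted_derivation :: "complex^'n^'n \<Rightarrow> complex \<Rightarrow> complex^'n^'n \<Rightarrow> complex^'n^'n" where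
  "shifted_derivation A z X = inner_derivation A X - mat_scale z X"

lemma shifted_derivation_zero [simp]: "shifted_derivation A z 0 = 0"
  by (simp add: shifted_derivation_def)

lemma shifted_derivation_0_left [simp]: "shifted_derivation A 0 X = inner_derivation A X"
  by (simp add: shifted_derivation_def)

lemma shifted_derivation_add:
  "shifted_derivation A z (X + Y) = shifted_derivation A z X + shifted_derivation A z Y"
  by (simp add: shifted_derivation_def inner_derivation_add mat_scale_add_right)

lemma shifted_derivation_commute:
  "shifted_derivation A z (shifted_derivation A w X)
   = shifted_derivation A w (shifted_derivation A z X)"
  by (simp add: shifted_derivation_def inner_derivation_diff inner_derivation_mat_scale
      mat_scale_diff_right mat_scale_mat_scale mult.commute)

text \<open>The Leibniz rule splits the shift, which is why eigenvalues add under multiplication.\<close>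

lemma shifted_derivation_mult:
  "shifted_derivation A (z + w) (X ** Y)
   = shifted_derivation A z X ** Y + X ** shifted_derivation A w Y"
  by (simp add: shifted_derivation_def inner_derivation_mult mat_scale_add_left
      matrix_diff_distrib_left matrix_diff_distrib_right mat_scale_mult_left mat_scale_mult_right)

text \<open>
  In terms of the generalized eigenspaces of the derivation, this is membership in the sum of those
  whose eigenvalue \<open>z\<close> lies in the half plane \<open>Re (u * z) \<ge> r\<close>. The inductive form lets the
  closure properties below be proved without any spectral decomposition.
\<close>

inductive weight_ge :: "complex^'n^'n \<Rightarrow> complex \<Rightarrow> real \<Rightarrow> complex^'n^'n \<Rightarrow> bool"
  for A u r where
  zero: "weight_ge A u r 0"
| step: "Re (u * z) \<ge> r \<Longrightarrow> weight_ge A u r (shifted_derivation A z X) \<Longrightarrow> weight_ge A u r X"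

lemma weight_ge_shifted_derivation:
  "weight_ge A u r X \<Longrightarrow> weight_ge A u r (shifted_derivation A w X)"
proof (induction rule: weight_ge.induct)
  case zero
  show ?case by (simp add: weight_ge.zero)
next
  case (step z X)
  then show ?case
    by (metis shifted_derivation_commute weight_ge.step)
qed

lemma weight_ge_funpow_inner_derivation:
  "weight_ge A u r X \<Longrightarrow> weight_ge A u r ((inner_derivation A ^^ j) X)"
proof (induction j)
  case (Suc j)
  then show ?case
    using weight_ge_shifted_derivation[where w = 0] by auto
qed auto

lemma weight_ge_add:
  "weight_ge A u r X \<Longrightarrow> weight_ge A u r Y \<Longrightarrow> weight_ge A u r (X + Y)"
proof (induction arbitrary: Y rule: weight_ge.induct)
  case (step z X)
  have "weight_ge A u r (shifted_derivation A z (X + Y))"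
    unfolding shifted_derivation_add
    using step by (intro step.IH weight_ge_shifted_derivation)
  with step.hyps(1) show ?case by (rule weight_ge.step)
qed simp

text \<open>
  By \<open>shifted_derivation_mult\<close>, applying the derivation shifted by \<open>z + w\<close> to the product shortens
  the annihilating chain of one of the two factors in each summand; hence the double induction.
\<close>

lemma weight_ge_mult:
  assumes "weight_ge A u r X" and "weight_ge A u s Y"
  shows "weight_ge A u (r + s) (X ** Y)"
  using assms
proof (induction arbitrary: Y rule: weight_ge.induct)
  case zero
  then show ?case by (simp add: weight_ge.zero)
next
  case (step z X)
  from step.prems show ?case
  proof (induction rule: weight_ge.induct)
    case zero
    show ?case by (simp add: weight_ge.zero)
  next
    case (step w Y)
    have "weight_ge A u s Y"
      using step.hyps by (rule weight_ge.step)
    then have "weight_ge A u (r + s) (shifted_derivation A z X ** Y)"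
      by (rule \<open>\<And>Y. weight_ge A u s Y \<Longrightarrow> weight_ge A u (r + s) (shifted_derivation A z X ** Y)\<close>)
    then have "weight_ge A u (r + s) (shifted_derivation A (z + w) (X ** Y))"
      unfolding shifted_derivation_mult using step.IH by (rule weight_ge_add)
    moreover have "r + s \<le> Re (u * (z + w))"
      using \<open>r \<le> Re (u * z)\<close> \<open>s \<le> Re (u * w)\<close> by (simp add: algebra_simps)
    ultimately show ?case by (metis weight_ge.step)
  qed
qed

lemma weight_ge_mat_power:
  assumes "weight_ge A u r X"
  shows "weight_ge A u (real k * r) (mat_power X k)"
proof (induction k)
  case 0
  \<comment> \<open>The identity is an eigenvector for the eigenvalue \<open>0\<close>.\<close>
  have "weight_ge A u 0 (shifted_derivation A 0 (mat 1))"
    by (simp add: weight_ge.zero)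
  then show ?case
    using weight_ge.step[of 0 u 0 A "mat 1"] by simp
next
  case (Suc k)
  then show ?case
    using weight_ge_mult[OF assms Suc.IH] by (simp add: algebra_simps)
qed

text \<open>
  An eigenvalue in the half plane has modulus at least \<open>r\<close>. Once \<open>r\<close> exceeds the operator norm
  of the derivation, the half plane thus contains no eigenvalue at all.
\<close>

lemma weight_ge_large_imp_zero:
  assumes "cmod u = 1"
  obtains B where "B > 0" and "\<And>r X. r > B \<Longrightarrow> weight_ge A u r X \<Longrightarrow> X = 0"
proof -
  obtain B where "B > 0" and B: "\<And>X. norm (inner_derivation A X) \<le> B * norm X"
    using linear_bounded_pos[OF linear_inner_derivation] by blast
  have "X = 0" if "weight_ge A u r X" and "r > B" for r X
    using that
  proof (induction rule: weight_ge.induct)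
    case (step z X)
    have "r \<le> cmod z"
      using step.hyps(1) complex_Re_le_cmod[of "u * z"] assms by (simp add: norm_mult)
    moreover have "inner_derivation A X = mat_scale z X"
      using step by (simp add: shifted_derivation_def)
    then have "cmod z * norm X \<le> B * norm X"
      using B[of X] by (simp add: norm_mat_scale)
    ultimately show "X = 0"
      using \<open>r > B\<close> by (cases "X = 0") auto
  qed simp
  with \<open>B > 0\<close> show ?thesis using that by blast
qed

lemma weight_ge_pos_imp_nilpotent:
  assumes "cmod u = 1" and "r > 0" and "weight_ge A u r X"
  shows "nilpotent_mat X"
proof -
  obtain B where "B > 0" and B: "\<And>r X. r > B \<Longrightarrow> weight_ge A u r X \<Longrightarrow> X = 0"
    using weight_ge_large_imp_zero[OF assms(1)] by blast
  obtain k :: nat where k: "B < real k * r"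
    using reals_Archimedean3[OF \<open>r > 0\<close>] by blast
  then have "mat_power X k = 0"
    using B weight_ge_mat_power[OF assms(3)] by blast
  moreover have "k \<ge> 1"
    using k \<open>B > 0\<close> by (cases k) auto
  ultimately show ?thesis
    unfolding nilpotent_mat_def by blast
qed

section \<open>Polynomials in the derivation\<close>

definition poly_derivation :: "complex poly \<Rightarrow> complex^'n^'n \<Rightarrow> complex^'n^'n \<Rightarrow> complex^'n^'n" where
  "poly_derivation p A X = (\<Sum>k\<le>degree p. mat_scale (coeff p k) ((inner_derivation A ^^ k) X))"

lemma poly_derivation_altdef:
  assumes "degree p \<le> N"
  shows "poly_derivation p A X = (\<Sum>k\<le>N. mat_scale (coeff p k) ((inner_derivation A ^^ k) X))"
  unfolding poly_derivation_def using assms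
  by (intro sum.mono_neutral_left) (auto simp: coeff_eq_0)

lemma poly_derivation_diff:
  "poly_derivation (p - q) A X = poly_derivation p A X - poly_derivation q A X"
proof -
  define N where "N = max (degree p) (degree q)"
  have "degree p \<le> N" "degree q \<le> N" "degree (p - q) \<le> N"
    by (auto simp: N_def degree_diff_le)
  then show ?thesis
    by (simp add: poly_derivation_altdef[of _ N] mat_scale_diff_left sum_subtractf)
qed

lemma poly_derivation_smult: "poly_derivation (smult a p) A X = mat_scale a (poly_derivation p A X)"
proof -
  have "poly_derivation (smult a p) A X
      = (\<Sum>k\<le>degree p. mat_scale (coeff (smult a p) k) ((inner_derivation A ^^ k) X))"
    by (rule poly_derivation_altdef) (rule degree_smult_le)
  then show ?thesis
    by (simp add: poly_derivation_def mat_scale_sum mat_scale_mat_scale)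
qed

lemma poly_derivation_pCons_0:
  "poly_derivation (pCons 0 p) A X = poly_derivation p A (inner_derivation A X)"
proof -
  have "poly_derivation (pCons 0 p) A X
      = (\<Sum>k\<le>Suc (degree p). mat_scale (coeff (pCons 0 p) k) ((inner_derivation A ^^ k) X))"
    by (rule poly_derivation_altdef) (rule degree_pCons_le)
  then show ?thesis
    by (simp only: sum.atMost_Suc_shift)
      (simp add: poly_derivation_def funpow_Suc_right del: funpow.simps)
qed

lemma poly_derivation_shifted_derivation:
  "poly_derivation p A (shifted_derivation A z X)
   = poly_derivation p A (inner_derivation A X) - mat_scale z (poly_derivation p A X)"
proof -
  have "(inner_derivation A ^^ k) (shifted_derivation A z X)
      = (inner_derivation A ^^ k) (inner_derivation A X)
        - mat_scale z ((inner_derivation A ^^ k) X)" for k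
    by (induction k)
      (simp_all add: shifted_derivation_def inner_derivation_diff inner_derivation_mat_scale)
  then show ?thesis
    by (simp add: poly_derivation_def mat_scale_diff_right sum_subtractf mat_scale_sum
        mat_scale_mat_scale mult.commute)
qed

lemma poly_derivation_linear_factor:
  "poly_derivation ([:-z, 1:] * p) A X = poly_derivation p A (shifted_derivation A z X)"
proof -
  have "[:-z, 1:] * p = pCons 0 p - smult z p"
    by (simp add: mult_pCons_left)
  then show ?thesis
    by (simp add: poly_derivation_diff poly_derivation_smult poly_derivation_pCons_0
        poly_derivation_shifted_derivation)
qed

text \<open>Factoring the polynomial into \<open>[:-z, 1:]\<close> and peeling off one factor at a time yields the chain
  of shifted derivations that \<open>weight_ge\<close> asks for.\<close>

lemma poly_derivation_eq_0_imp_weight_ge: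
  assumes "p \<noteq> 0" and "poly_derivation p A X = 0"
    and roots: "\<And>z. poly p z = 0 \<Longrightarrow> Re (u * z) \<ge> r"
  shows "weight_ge A u r X"
proof -
  obtain Z where "size Z = degree p" and p: "p = smult (lead_coeff p) (\<Prod>z\<in>#Z. [:-z, 1:])"
    using alg_closed_imp_factorization[OF \<open>p \<noteq> 0\<close>] by blast
  have *: "weight_ge A u r X"
    if "\<And>z. z \<in># Z \<Longrightarrow> Re (u * z) \<ge> r" and "poly_derivation (\<Prod>z\<in>#Z. [:-z, 1:]) A X = 0"
    for X and Z :: "complex multiset"
    using that
  proof (induction Z arbitrary: X)
    case empty
    then have "X = 0" by (simp add: poly_derivation_def)
    then show ?case by (simp add: weight_ge.zero)
  next
    case (add z Z)
    have "poly_derivation (\<Prod>z\<in>#Z. [:-z, 1:]) A (shifted_derivation A z X) = 0"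
      using add.prems(2)
      by (simp only: image_mset_add_mset prod_mset.add_mset poly_derivation_linear_factor)
    then have "weight_ge A u r (shifted_derivation A z X)"
      using add.IH add.prems(1) by simp
    then show ?case
      using add.prems(1)[of z] by (metis weight_ge.step union_single_eq_member)
  qed
  have "poly p z = 0" if "z \<in># Z" for z
  proof -
    have "poly (\<Prod>z\<in>#Z. [:-z, 1:]) z = 0"
      using that by (induction Z) auto
    then show ?thesis by (subst p) simp
  qed
  moreover have "poly_derivation (\<Prod>z\<in>#Z. [:-z, 1:]) A X = 0"
    using assms(1,2) by (subst (asm) p) (simp add: poly_derivation_smult mat_scale_eq_0_iff)
  ultimately show ?thesis
    using * roots by blast
qed

section \<open>Nilpotency\<close>

theorem theorem7p1:
  fixes A T :: "complex^'n^'n" and c :: "nat \<Rightarrow> complex" and m :: nat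
  assumes "m \<ge> 1"
    and "c m \<noteq> 0"
    and "(\<Sum>k=0..m. mat_scale (c k) ((inner_derivation A ^^ k) T)) = 0"
    and "\<exists>\<theta>::real. \<forall>z::complex. (\<Sum>k=0..m. c k * z ^ k) = 0 \<longrightarrow>
           Re (exp (- (\<i> * complex_of_real \<theta>)) * z) > 0"
  shows "(\<forall>j::nat. nilpotent_mat ((inner_derivation A ^^ j) T))
         \<and> nilpotent_mat T \<and> nilpotent_mat (inner_derivation A T)"
proof -
  obtain \<theta> :: real where \<theta>: "\<And>z::complex. (\<Sum>k=0..m. c k * z ^ k) = 0 \<Longrightarrow>
           Re (exp (- (\<i> * complex_of_real \<theta>)) * z) > 0"
    using assms(4) by blast
  define u where "u = exp (- (\<i> * complex_of_real \<theta>))"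
  have u: "cmod u = 1"
    by (simp add: u_def)
  define p where "p = (\<Sum>k\<le>m. monom (c k) k)"
  have coeff_p: "coeff p k = (if k \<le> m then c k else 0)" for k
    by (simp add: p_def coeff_sum)
  have "degree p \<le> m"
    by (rule degree_le) (simp add: coeff_p)
  have "p \<noteq> 0"
    using coeff_p[of m] assms(2) by auto
  have annihilates: "poly_derivation p A T = 0"
    using assms(3) by (simp add: poly_derivation_altdef[OF \<open>degree p \<le> m\<close>] coeff_p atLeast0AtMost)
  have roots: "Re (u * z) > 0" if "poly p z = 0" for z
    using that \<theta>[of z] by (simp add: u_def p_def poly_sum poly_monom atLeast0AtMost)

  \<comment> \<open>Inserting \<open>1\<close> makes the set visibly nonempty and keeps its elements positive.\<close>
  define r where "r = Min (insert 1 ((\<lambda>z. Re (u * z)) ` {z. poly p z = 0}))"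
  have fin: "finite {z. poly p z = 0}"
    using \<open>p \<noteq> 0\<close> by (rule poly_roots_finite)
  have "r > 0"
    using fin roots by (auto simp: r_def)
  have "Re (u * z) \<ge> r" if "poly p z = 0" for z
    using fin that by (auto simp: r_def)
  then have "weight_ge A u r T"
    by (rule poly_derivation_eq_0_imp_weight_ge[OF \<open>p \<noteq> 0\<close> annihilates])
  then have nil: "nilpotent_mat ((inner_derivation A ^^ j) T)" for j
    using weight_ge_pos_imp_nilpotent[OF u \<open>r > 0\<close>] weight_ge_funpow_inner_derivation by blast
  show ?thesis
    using nil nil[of 0] nil[of 1] by simp
qed

end
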